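(* Let $n\geq 7$ be an integer and let $G$ be an edge-colored $K^{(3)}_n$ containing no rainbow copy of the messy path $\mathcal{M}$. Then $|C(G)|\leq 2$.
   Context: An edge-coloring of a hypergraph $G$ is any map $c:E(G)\to\mathbb{N}$ (not necessarily proper); $C(G)=\{c(e):e\in E(G)\}$. A copy of $H$ in $G$ is a subhypergraph isomorphic to $H$; it is rainbow if its edges have pairwise distinct colors. $K^{(3)}_n$ is the complete 3-uniform hypergraph on $n$ vertices. The messy path $\mathcal{M}$ is the 3-graph with vertices $v_1,\ldots,v_6$ and edges $\{v_1v_2v_3, v_2v_3v_4, v_4v_5v_6\}$. *)

theory Defs
  imports Main
begin

record 'a hypergraph =
  verts :: "'a set"
  edges :: "'a set set"

definition wf_hypergraph :: "'a hypergraph \<Rightarrow> bool" where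
  "wf_hypergraph H \<longleftrightarrow> (\<forall>e\<in>edges H. e \<subseteq> verts H)"

definition subhypergraph :: "'a hypergraph \<Rightarrow> 'a hypergraph \<Rightarrow> bool" where
  "subhypergraph H G \<longleftrightarrow> wf_hypergraph H \<and> verts H \<subseteq> verts G \<and> edges H \<subseteq> edges G"

definition isomorphic :: "'a hypergraph \<Rightarrow> 'b hypergraph \<Rightarrow> bool" where
  "isomorphic H F \<longleftrightarrow>
     (\<exists>f. bij_betw f (verts H) (verts F) \<and> (\<lambda>e. f ` e) ` edges H = edges F)"

definition is_copy :: "'a hypergraph \<Rightarrow> 'b hypergraph \<Rightarrow> 'a hypergraph \<Rightarrow> bool" where
  "is_copy H F G \<longleftrightarrow> subhypergraph H G \<and> isomorphic H F"

text \<open>An edge-coloring of \<open>G\<close> is a total function on sets of vertices; only its values on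
  \<open>edges G\<close> matter.\<close>

definition colors :: "('a set \<Rightarrow> nat) \<Rightarrow> 'a hypergraph \<Rightarrow> nat set" where
  "colors c G = c ` edges G"

definition rainbow :: "('a set \<Rightarrow> nat) \<Rightarrow> 'a hypergraph \<Rightarrow> bool" where
  "rainbow c H \<longleftrightarrow> inj_on c (edges H)"

definition is_complete_hypergraph :: "nat \<Rightarrow> nat \<Rightarrow> 'a hypergraph \<Rightarrow> bool" where
  "is_complete_hypergraph k n G \<longleftrightarrow>
     finite (verts G) \<and> card (verts G) = n \<and> edges G = {e. e \<subseteq> verts G \<and> card e = k}"

definition messy_path :: "nat hypergraph" where
  "messy_path = \<lparr>verts = {1, 2, 3, 4, 5, 6}, edges = {{1, 2, 3}, {2, 3, 4}, {4, 5, 6}}\<rparr>"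

end

theory Submission
  imports Defs
begin

text \<open>
  Let \<open>abc\<close> and \<open>bcd\<close> be edges with different colours \<open>p\<close> and \<open>q\<close>. Then every edge \<open>T\<close> has
  colour \<open>p\<close> or \<open>q\<close>. If \<open>T\<close> meets \<open>{a, b, c, d}\<close> exactly in \<open>a\<close> or exactly in \<open>d\<close>, this says
  that the messy path formed by the three edges is not rainbow. Up to the symmetries
  \<open>b \<leftrightarrow> c\<close> and \<open>a \<leftrightarrow> d\<close> six positions of \<open>T\<close> remain; each reduces to earlier ones through one
  or two auxiliary edges, and seven vertices suffice throughout. If there is no such pair
  \<open>abc\<close>, \<open>bcd\<close>, then exchanging one vertex at a time shows that all edges have the same colour.
\<close>

locale messy_free_coloring =
  fixes V :: "'a set" and col :: "'a set \<Rightarrow> nat"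
  assumes card_V: "card V \<ge> 7"
    and end_not_rainbow: "\<lbrakk>distinct [a, b, c, d, x, y]; {a, b, c, d, x, y} \<subseteq> V\<rbrakk>
      \<Longrightarrow> \<not> distinct [col {a, b, c}, col {b, c, d}, col {d, x, y}]"
begin

lemma fresh_vertex:
  assumes "length vs < 7"
  obtains v where "v \<in> V" "v \<notin> set vs"
proof -
  have "card (set vs) < card V"
    using card_length[of vs] assms card_V by linarith
  then have "\<not> V \<subseteq> set vs"
    using card_mono[of "set vs" V] by auto
  then show thesis using that by blast
qed

text \<open>Here and in the next five lemmas let p, q, r be the colours in the conclusion, supposed
  distinct. Two messy paths through ayz force it to have colour p, two through bcz force colour r;
  then bcd, bcz, ayz form a rainbow messy path.\<close>

lemma disjoint_not_rainbow:
  assumes "distinct [a, b, c, d, x, y, z]" "{a, b, c, d, x, y, z} \<subseteq> V"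
  shows "\<not> distinct [col {a, b, c}, col {b, c, d}, col {x, y, z}]"
  using assms end_not_rainbow[of d b c a y z] end_not_rainbow[of a b c z x y]
    end_not_rainbow[of d b c z x y] end_not_rainbow[of x y z a b c]
    end_not_rainbow[of d b c z a y]
  by (simp add: insert_commute) metis

text \<open>For fresh z, the pair xyz, bxy continues at b by bcd or by abc. Both messy paths
  together force colour r on xyz, against the disjoint case.\<close>

lemma middle_not_rainbow:
  assumes "distinct [a, b, c, d, x, y]" "{a, b, c, d, x, y} \<subseteq> V"
  shows "\<not> distinct [col {a, b, c}, col {b, c, d}, col {b, x, y}]"
proof -
  obtain z where "z \<in> V" "z \<notin> set [a, b, c, d, x, y]"
    by (rule fresh_vertex[of "[a, b, c, d, x, y]"]) simp_all
  then show ?thesis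
    using assms end_not_rainbow[of z x y b c d] end_not_rainbow[of z x y b a c]
      disjoint_not_rainbow[of a b c d x y z]
    by (simp add: insert_commute) metis
qed

text \<open>For fresh y, the pair adx, dxy meets bcd only in d and abc only in a. So dxy has colour
  r, and abc, bcd, dxy is a rainbow messy path.\<close>

lemma both_ends_not_rainbow:
  assumes "distinct [a, b, c, d, x]" "{a, b, c, d, x} \<subseteq> V"
  shows "\<not> distinct [col {a, b, c}, col {b, c, d}, col {a, d, x}]"
proof -
  obtain y where "y \<in> V" "y \<notin> set [a, b, c, d, x]"
    by (rule fresh_vertex[of "[a, b, c, d, x]"]) simp_all
  then show ?thesis
    using assms middle_not_rainbow[of a d x y b c] end_not_rainbow[of y d x a b c]
      end_not_rainbow[of a b c d x y]
    by (simp add: insert_commute) metis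
qed

text \<open>For fresh z, the edge axz has colour p or q by the path bcd, abc, axz, and p or r by the
  previous lemma applied to abc, bcx. So it has colour p, and bcd, bcx, axz is a rainbow messy
  path.\<close>

lemma both_middles_not_rainbow:
  assumes "distinct [a, b, c, d, x]" "{a, b, c, d, x} \<subseteq> V"
  shows "\<not> distinct [col {a, b, c}, col {b, c, d}, col {b, c, x}]"
proof -
  obtain z where "z \<in> V" "z \<notin> set [a, b, c, d, x]"
    by (rule fresh_vertex[of "[a, b, c, d, x]"]) simp_all
  then show ?thesis
    using assms end_not_rainbow[of d b c a x z] both_ends_not_rainbow[of a b c x z]
      end_not_rainbow[of d b c x a z]
    by (simp add: insert_commute) metis
qed

text \<open>Any two of the three edges share two vertices. For fresh y, z, pairing abd with abc and
  with bcd gives cyz colour r, but c is a middle vertex of abc, bcd.\<close>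

lemma inside_not_rainbow:
  assumes "distinct [a, b, c, d]" "{a, b, c, d} \<subseteq> V"
  shows "\<not> distinct [col {a, b, c}, col {b, c, d}, col {a, b, d}]"
proof -
  obtain y where y: "y \<in> V" "y \<notin> set [a, b, c, d]"
    by (rule fresh_vertex[of "[a, b, c, d]"]) simp_all
  obtain z where "z \<in> V" "z \<notin> set [a, b, c, d, y]"
    by (rule fresh_vertex[of "[a, b, c, d, y]"]) simp_all
  with y show ?thesis
    using assms end_not_rainbow[of d a b c y z] end_not_rainbow[of a b d c y z]
      middle_not_rainbow[of a c b d y z]
    by (simp add: insert_commute) metis
qed

text \<open>For fresh y, z, the middle case at b gives bdz colour r, and ayz has colour p because
  both q and r are possible only once. Then bcd, bdz, ayz is a rainbow messy path.\<close>

lemma end_middle_not_rainbow: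
  assumes "distinct [a, b, c, d, x]" "{a, b, c, d, x} \<subseteq> V"
  shows "\<not> distinct [col {a, b, c}, col {b, c, d}, col {a, b, x}]"
proof -
  obtain y where y: "y \<in> V" "y \<notin> set [a, b, c, d, x]"
    by (rule fresh_vertex[of "[a, b, c, d, x]"]) simp_all
  obtain z where "z \<in> V" "z \<notin> set [a, b, c, d, x, y]"
    by (rule fresh_vertex[of "[a, b, c, d, x, y]"]) simp_all
  with y show ?thesis
    using assms middle_not_rainbow[of c b a x d z] middle_not_rainbow[of c b d z a x]
      end_not_rainbow[of d b c a y z] middle_not_rainbow[of c a b x y z]
      end_not_rainbow[of c b d z a y]
    by (simp add: insert_commute) metis
qed

lemma tight_pair_determines_colors:
  assumes A: "distinct [a, b, c, d]" "{a, b, c, d} \<subseteq> V"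
    and ne: "col {a, b, c} \<noteq> col {b, c, d}"
    and T: "T \<subseteq> V" "card T = 3"
  shows "col T \<in> {col {a, b, c}, col {b, c, d}}"
proof -
  \<comment> \<open>The cases \<open>zero\<close> to \<open>three\<close> count the vertices of
    \<open>T\<close> in \<open>?A\<close>.\<close>
  let ?A = "{a, b, c, d}" and ?P = "\<lambda>T. col T \<in> {col {a, b, c}, col {b, c, d}}"
  have zero: "?P {x, y, z}"
    if "x \<in> V - ?A" "y \<in> V - ?A" "z \<in> V - ?A" "distinct [x, y, z]" for x y z
    using that A ne disjoint_not_rainbow[of a b c d x y z] by auto
  have one: "?P {s, x, y}"
    if s: "s \<in> ?A" and "x \<in> V - ?A" "y \<in> V - ?A" "x \<noteq> y" for s x y
  proof -
    have "?P {a, x, y}" "?P {d, x, y}" "?P {b, x, y}" "?P {c, x, y}"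
      using that(2-) A ne end_not_rainbow[of d b c a x y] end_not_rainbow[of a b c d x y]
        middle_not_rainbow[of a b c d x y] middle_not_rainbow[of a c b d x y]
      by (auto simp: insert_commute)
    with s show ?thesis by blast
  qed
  have two: "?P {s, t, x}"
    if st: "s \<in> ?A" "t \<in> ?A" "s \<noteq> t" and x: "x \<in> V - ?A" for s t x
  proof -
    have "?P {a, d, x}" "?P {b, c, x}" "?P {a, b, x}" "?P {a, c, x}" "?P {b, d, x}" "?P {c, d, x}"
      \<comment> \<open>The swaps of b with c and of a with d carry the pair ab to ac, bd and
        cd.\<close>
      using x A ne both_ends_not_rainbow[of a b c d x] both_middles_not_rainbow[of a b c d x]
        end_middle_not_rainbow[of a b c d x] end_middle_not_rainbow[of a c b d x]
        end_middle_not_rainbow[of d b c a x] end_middle_not_rainbow[of d c b a x]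
      by (auto simp: insert_commute)
    with st show ?thesis by (auto simp: insert_commute)
  qed
  have three: "?P {s, t, u}" if st: "s \<in> ?A" "t \<in> ?A" "u \<in> ?A" "distinct [s, t, u]" for s t u
  proof -
    \<comment> \<open>The other two triples inside \<open>?A\<close> are the given edges
      themselves.\<close>
    have "?P {a, b, d}" "?P {a, c, d}"
      using A ne inside_not_rainbow[of a b c d] inside_not_rainbow[of a c b d]
      by (auto simp: insert_commute)
    with st show ?thesis by (auto simp: insert_commute)
  qed
  obtain s t u where T_eq: "T = {s, t, u}" and dist: "distinct [s, t, u]"
    using T(2) by (auto simp: card_3_iff)
  \<comment> \<open>\<open>one\<close> and \<open>two\<close> expect the vertices in
    \<open>?A\<close> to be listed first.\<close>
  have perm: "{s, t, u} = {t, u, s}" "{s, t, u} = {s, u, t}" "{s, t, u} = {u, s, t}"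
    "{s, t, u} = {t, s, u}"
    by auto
  have V: "s \<in> V" "t \<in> V" "u \<in> V" using T(1) T_eq by auto
  show ?thesis
  proof (cases "s \<in> ?A"; cases "t \<in> ?A"; cases "u \<in> ?A")
    assume "s \<in> ?A" "t \<in> ?A" "u \<in> ?A"
    then show ?thesis using three[of s t u] T_eq dist by blast
  next
    assume "s \<in> ?A" "t \<in> ?A" "u \<notin> ?A"
    then show ?thesis using two[of s t u] T_eq dist V by auto
  next
    assume "s \<in> ?A" "t \<notin> ?A" "u \<in> ?A"
    then show ?thesis using two[of s u t] dist V unfolding T_eq perm(2) by auto
  next
    assume "s \<in> ?A" "t \<notin> ?A" "u \<notin> ?A"
    then show ?thesis using one[of s t u] T_eq dist V by auto
  next
    assume "s \<notin> ?A" "t \<in> ?A" "u \<in> ?A"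
    then show ?thesis using two[of t u s] dist V unfolding T_eq perm(1) by auto
  next
    assume "s \<notin> ?A" "t \<in> ?A" "u \<notin> ?A"
    then show ?thesis using one[of t s u] dist V unfolding T_eq perm(4) by auto
  next
    assume "s \<notin> ?A" "t \<notin> ?A" "u \<in> ?A"
    then show ?thesis using one[of u s t] dist V unfolding T_eq perm(3) by auto
  next
    assume "s \<notin> ?A" "t \<notin> ?A" "u \<notin> ?A"
    then show ?thesis using zero[of s t u] T_eq dist V by auto
  qed
qed

end

lemma constant_if_constant_on_tight_pairs:
  assumes tight: "\<And>a b c d. \<lbrakk>distinct [a, b, c, d]; {a, b, c, d} \<subseteq> V\<rbrakk>
      \<Longrightarrow> f {a, b, c} = f {b, c, d}"
    and "S \<subseteq> V" "card S = 3" and T: "T \<subseteq> V" "card T = 3"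
  shows "f S = f T"
  using assms(2,3)
proof (induction "card (S - T)" arbitrary: S rule: less_induct)
  case less
  have fin: "finite S" "finite T"
    using less.prems(2) T(2) by (auto intro: card_ge_0_finite)
  show ?case
  proof (cases "S \<subseteq> T")
    case True
    then show ?thesis using card_subset_eq[OF fin(2)] less.prems(2) T(2) by metis
  next
    case False
    then obtain s where s: "s \<in> S" "s \<notin> T" by blast
    have "\<not> T \<subseteq> S"
      using card_subset_eq[OF fin(1)] less.prems(2) T(2) s by metis
    then obtain t where t: "t \<in> T" "t \<notin> S" by blast
    have "card (S - {s}) = 2" using s(1) less.prems(2) fin(1) by simp
    then obtain b c where bc: "S - {s} = {b, c}" "b \<noteq> c" by (auto simp: card_2_iff)
    \<comment> \<open>The exchanged triple shares b and c with \<open>S\<close>, so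
      \<open>tight\<close> applies, and it is closer to \<open>T\<close>.\<close>
    let ?S' = "insert t (S - {s})"
    have S_eq: "S = {s, b, c}" and S'_eq: "?S' = {b, c, t}" using bc s(1) by auto
    have neq: "b \<noteq> s" "c \<noteq> s" using bc(1) by blast+
    have "f S = f ?S'"
      unfolding S'_eq unfolding S_eq using tight[of s b c t] bc(2) neq t less.prems(1) T(1) S_eq
      by auto
    also have "f ?S' = f T"
    proof (rule less.hyps)
      show "card (?S' - T) < card (S - T)"
        using fin s t by (intro psubset_card_mono) auto
      show "?S' \<subseteq> V" using less.prems(1) T(1) t by auto
      show "card ?S' = 3" using less.prems(2) fin(1) s(1) t(2) by simp
    qed
    finally show ?thesis .
  qed
qed

lemma messy_path_copy:
  assumes dist: "distinct [a, b, c, d, x, y]" and sub: "{a, b, c, d, x, y} \<subseteq> verts G"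
    and E: "{{a, b, c}, {b, c, d}, {d, x, y}} \<subseteq> edges G"
  shows "is_copy \<lparr>verts = {a, b, c, d, x, y}, edges = {{a, b, c}, {b, c, d}, {d, x, y}}\<rparr>
    messy_path G"
proof -
  define f :: "'a \<Rightarrow> nat" where
    "f v = (if v = a then 1 else if v = b then 2 else if v = c then 3
      else if v = d then 4 else if v = x then 5 else 6)" for v
  have f: "f a = 1" "f b = 2" "f c = 3" "f d = 4" "f x = 5" "f y = 6"
    using dist by (auto simp: f_def)
  have "bij_betw f {a, b, c, d, x, y} {1, 2, 3, 4, 5, 6}"
    unfolding bij_betw_def inj_on_def using f by auto
  moreover have "(`) f ` {{a, b, c}, {b, c, d}, {d, x, y}} = {{1, 2, 3}, {2, 3, 4}, {4, 5, 6}}"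
    using f by simp
  ultimately have "isomorphic
    \<lparr>verts = {a, b, c, d, x, y}, edges = {{a, b, c}, {b, c, d}, {d, x, y}}\<rparr> messy_path"
    unfolding isomorphic_def messy_path_def by auto
  then show ?thesis
    using sub E by (auto simp: is_copy_def subhypergraph_def wf_hypergraph_def)
qed

lemma messy_free_coloringI:
  assumes "n \<ge> 7" and G: "is_complete_hypergraph 3 n G"
    and free: "\<not> (\<exists>H. is_copy H messy_path G \<and> rainbow c H)"
  shows "messy_free_coloring (verts G) c"
proof
  show "card (verts G) \<ge> 7"
    using assms(1) G by (auto simp: is_complete_hypergraph_def)
next
  fix u v w z x y
  assume dist: "distinct [u, v, w, z, x, y]" and sub: "{u, v, w, z, x, y} \<subseteq> verts G"
  let ?H = "\<lparr>verts = {u, v, w, z, x, y}, edges = {{u, v, w}, {v, w, z}, {z, x, y}}\<rparr>"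
  have "{{u, v, w}, {v, w, z}, {z, x, y}} \<subseteq> edges G"
    using dist sub G by (auto simp: is_complete_hypergraph_def)
  then have "\<not> rainbow c ?H"
    using messy_path_copy[OF dist sub] free by blast
  \<comment> \<open>Non-injectivity gives two different edges of equal colour, hence a repetition in
    the list.\<close>
  then show "\<not> distinct [c {u, v, w}, c {v, w, z}, c {z, x, y}]"
    by (auto simp: rainbow_def inj_on_def)
qed

theorem theorem1p4:
  fixes n :: nat and G :: "'a hypergraph" and c :: "'a set \<Rightarrow> nat"
  assumes "n \<ge> 7"
    and "is_complete_hypergraph 3 n G"
    and "\<not> (\<exists>H. is_copy H messy_path G \<and> rainbow c H)"
  shows "card (colors c G) \<le> 2"
proof -
  interpret messy_free_coloring "verts G" c
    using assms by (rule messy_free_coloringI)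
  have E: "edges G = {e. e \<subseteq> verts G \<and> card e = 3}"
    using assms(2) by (simp add: is_complete_hypergraph_def)
  have "\<exists>p q. colors c G \<subseteq> {p, q}"
  proof (cases "\<exists>u v w z. distinct [u, v, w, z] \<and> {u, v, w, z} \<subseteq> verts G
      \<and> c {u, v, w} \<noteq> c {v, w, z}")
    case True
    then obtain u v w z where "distinct [u, v, w, z]" "{u, v, w, z} \<subseteq> verts G"
      "c {u, v, w} \<noteq> c {v, w, z}" by blast
    from tight_pair_determines_colors[OF this]
    have "colors c G \<subseteq> {c {u, v, w}, c {v, w, z}}"
      unfolding colors_def E by blast
    then show ?thesis by blast
  next
    case False
    then have "c S = c T" if "S \<in> edges G" "T \<in> edges G" for S T
      using that constant_if_constant_on_tight_pairs[of "verts G" c S T] E by blast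
    then have "colors c G \<subseteq> {p, p}" if "p \<in> colors c G" for p
      using that unfolding colors_def by blast
    \<comment> \<open>Splitting off the empty colour set avoids exhibiting an edge.\<close>
    then show ?thesis by (cases "colors c G = {}") blast+
  qed
  then obtain p q where "colors c G \<subseteq> {p, q}" by blast
  then have "card (colors c G) \<le> card {p, q}" by (intro card_mono) auto
  also have "\<dots> \<le> 2" by (simp add: card_insert_if)
  finally show ?thesis .
qed

end
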